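(* Let $\mathscr S$ be a topos and $\mathbb C$ an internal category in $\mathscr S$. Let $\phi\colon X\to\Omega$ be a morphism in $[\mathbb C,\mathscr S]$, where $X$ is an internal diagram with structure map $\gamma\colon X\to C_0$ and $\Omega$ is the subobject classifier of $[\mathbb C,\mathscr S]$. Let $c\colon Z\to C_0$ and $a\colon Z\to X$ be morphisms of $\mathscr S$ with $\gamma a=c$. If $c\Vdash\phi(a)$ holds, then $d\Vdash\phi(f_!a)$ holds for all $f\colon c\to d$, that is, for all $f\colon Z\to C_1$ with $d_0f=c$ and $d_1f=d$.
   Context: An internal category $\mathbb C$ in $\mathscr S$ has object of objects $C_0$, object of arrows $C_1$, domain $d_0$ and codomain $d_1\colon C_1\to C_0$, identities $y\colon C_0\to C_1$ and composition $\otimes\colon C_1\times_{C_0}C_1\to C_1$. An internal diagram on $\mathbb C$ is a morphism $\gamma\colon X\to C_0$ with an action $m\colon X\times_{C_0}C_1\to X$ (pullback of $\gamma$ and $d_0$), with $\gamma m=d_1\pi_2$, satisfying the associativity law $m(m\times1)=m(1\times\otimes)$ and the unit law $m\langle 1,y\gamma\rangle=1_X$. Morphisms of internal diagrams are morphisms over $C_0$ commuting with the actions; they form a category $[\mathbb C,\mathscr S]$, which is a topos with terminal object $C_0$. For $\phi\colon X\to\Omega$ in $[\mathbb C,\mathscr S]$, let $u\colon S_\phi\to X$ be the pullback in $[\mathbb C,\mathscr S]$ of $\top\colon1\to\Omega$ along $\phi$. For $c\colon Z\to C_0$ and $a\colon Z\to X$ with $\gamma a=c$, $c\Vdash\phi(a)$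 means that $a$ factors through $u\colon S_\phi\to X$ (as a morphism of $\mathscr S$ over $C_0$). For $f\colon Z\to C_1$ with $d_0f=c$ and $d_1f=d$, $f_!a:=m\langle a,f\rangle\colon Z\to X$, a generalized element over $d$. *)

theory Defs
  imports Main
begin

section \<open>Categories\<close>

record ('o, 'a) cat =
  Obj :: "'o set"
  Arr :: "'a set"
  Dom :: "'a \<Rightarrow> 'o"
  Cod :: "'a \<Rightarrow> 'o"
  Id :: "'o \<Rightarrow> 'a"
  Comp :: "'a \<Rightarrow> 'a \<Rightarrow> 'a" (infixr "\<cdot>\<index>" 70)  \<comment> \<open>\<open>g \<cdot> f\<close> is \<open>g\<close> after \<open>f\<close>\<close>

definition hom :: "('o, 'a) cat \<Rightarrow> 'o \<Rightarrow> 'o \<Rightarrow> 'a set" where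
  "hom S A B = {f \<in> Arr S. Dom S f = A \<and> Cod S f = B}"

locale category =
  fixes S :: "('o, 'a) cat" (structure)
  assumes Dom_in_Obj: "f \<in> Arr S \<Longrightarrow> Dom S f \<in> Obj S"
    and Cod_in_Obj: "f \<in> Arr S \<Longrightarrow> Cod S f \<in> Obj S"
    and Id_hom: "A \<in> Obj S \<Longrightarrow> Id S A \<in> hom S A A"
    and Comp_hom: "f \<in> hom S A B \<Longrightarrow> g \<in> hom S B D \<Longrightarrow> g \<cdot> f \<in> hom S A D"
    and Id_left: "f \<in> hom S A B \<Longrightarrow> Id S B \<cdot> f = f"
    and Id_right: "f \<in> hom S A B \<Longrightarrow> f \<cdot> Id S A = f"
    and Comp_assoc: "f \<in> hom S A B \<Longrightarrow> g \<in> hom S B D \<Longrightarrow> h \<in> hom S D E \<Longrightarrow>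
      h \<cdot> (g \<cdot> f) = (h \<cdot> g) \<cdot> f"

definition is_terminal :: "('o, 'a) cat \<Rightarrow> 'o \<Rightarrow> bool" where
  "is_terminal S T \<longleftrightarrow> T \<in> Obj S \<and> (\<forall>A\<in>Obj S. \<exists>!f. f \<in> hom S A T)"

definition is_mono :: "('o, 'a) cat \<Rightarrow> 'a \<Rightarrow> bool" where
  "is_mono S i \<longleftrightarrow> i \<in> Arr S \<and>
    (\<forall>Z. \<forall>g\<in>hom S Z (Dom S i). \<forall>h\<in>hom S Z (Dom S i). i \<cdot>\<^bsub>S\<^esub> g = i \<cdot>\<^bsub>S\<^esub> h \<longrightarrow> g = h)"

definition is_product :: "('o, 'a) cat \<Rightarrow> 'o \<Rightarrow> 'o \<Rightarrow> 'a \<Rightarrow> 'a \<Rightarrow> bool" where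
  "is_product S A B p q \<longleftrightarrow> A \<in> Obj S \<and> B \<in> Obj S \<and>
    p \<in> hom S (Dom S p) A \<and> q \<in> hom S (Dom S p) B \<and>
    (\<forall>Z. \<forall>a\<in>hom S Z A. \<forall>b\<in>hom S Z B.
      \<exists>!h. h \<in> hom S Z (Dom S p) \<and> p \<cdot>\<^bsub>S\<^esub> h = a \<and> q \<cdot>\<^bsub>S\<^esub> h = b)"

definition is_pullback :: "('o, 'a) cat \<Rightarrow> 'a \<Rightarrow> 'a \<Rightarrow> 'a \<Rightarrow> 'a \<Rightarrow> bool" where
  "is_pullback S f g p q \<longleftrightarrow> f \<in> Arr S \<and> g \<in> Arr S \<and> Cod S f = Cod S g \<and>
    p \<in> hom S (Dom S p) (Dom S f) \<and> q \<in> hom S (Dom S p) (Dom S g) \<and>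
    f \<cdot>\<^bsub>S\<^esub> p = g \<cdot>\<^bsub>S\<^esub> q \<and>
    (\<forall>Z. \<forall>a\<in>hom S Z (Dom S f). \<forall>b\<in>hom S Z (Dom S g). f \<cdot>\<^bsub>S\<^esub> a = g \<cdot>\<^bsub>S\<^esub> b \<longrightarrow>
      (\<exists>!h. h \<in> hom S Z (Dom S p) \<and> p \<cdot>\<^bsub>S\<^esub> h = a \<and> q \<cdot>\<^bsub>S\<^esub> h = b))"

text \<open>The arrow \<open>\<langle>a, b\<rangle>\<close> into a product or pullback with projections \<open>p\<close> and \<open>q\<close>.\<close>

definition pairing :: "('o, 'a) cat \<Rightarrow> 'a \<Rightarrow> 'a \<Rightarrow> 'a \<Rightarrow> 'a \<Rightarrow> 'a" where
  "pairing S p q a b =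
    (THE h. h \<in> hom S (Dom S a) (Dom S p) \<and> p \<cdot>\<^bsub>S\<^esub> h = a \<and> q \<cdot>\<^bsub>S\<^esub> h = b)"

text \<open>\<open>ev\<close>, with domain the product (projections \<open>p\<close>, \<open>q\<close>) of \<open>E\<close> and \<open>A\<close>, exhibits \<open>E\<close> as the
  exponential \<open>B\<^sup>A\<close>; the transpose condition is \<open>ev \<cdot> (h \<times> 1) = f\<close>.\<close>

definition is_exponential ::
    "('o, 'a) cat \<Rightarrow> 'o \<Rightarrow> 'o \<Rightarrow> 'o \<Rightarrow> 'a \<Rightarrow> 'a \<Rightarrow> 'a \<Rightarrow> bool" where
  "is_exponential S A B E p q ev \<longleftrightarrow> is_product S E A p q \<and> ev \<in> hom S (Dom S p) B \<and>
    (\<forall>Z p' q' f. is_product S Z A p' q' \<longrightarrow> f \<in> hom S (Dom S p') B \<longrightarrow>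
      (\<exists>!h. h \<in> hom S Z E \<and> ev \<cdot>\<^bsub>S\<^esub> pairing S p q (h \<cdot>\<^bsub>S\<^esub> p') q' = f))"

definition is_subobject_classifier :: "('o, 'a) cat \<Rightarrow> 'o \<Rightarrow> 'a \<Rightarrow> bool" where
  "is_subobject_classifier S \<Omega> tr \<longleftrightarrow> is_terminal S (Dom S tr) \<and> tr \<in> hom S (Dom S tr) \<Omega> \<and>
    (\<forall>i. is_mono S i \<longrightarrow>
      (\<exists>!\<chi>. \<chi> \<in> hom S (Cod S i) \<Omega> \<and> (\<exists>t. is_pullback S \<chi> tr i t)))"

text \<open>Elementary toposes; a terminal object and pullbacks give all finite limits.\<close>

locale topos = category +
  assumes has_terminal: "\<exists>T. is_terminal S T"
    and has_pullbacks: "f \<in> hom S A D \<Longrightarrow> g \<in> hom S B D \<Longrightarrow> \<exists>p q. is_pullback S f g p q"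
    and has_exponentials: "A \<in> Obj S \<Longrightarrow> B \<in> Obj S \<Longrightarrow> \<exists>E p q ev. is_exponential S A B E p q ev"
    and has_classifier: "\<exists>\<Omega> tr. is_subobject_classifier S \<Omega> tr"

text \<open>A choice of pullbacks: \<open>pb1 S f g\<close> and \<open>pb2 S f g\<close> are the projections to the domains of
  \<open>f\<close> and \<open>g\<close>, and \<open>pbpair S f g a b\<close> is \<open>\<langle>a, b\<rangle>\<close>.\<close>

definition pb :: "('o, 'a) cat \<Rightarrow> 'a \<Rightarrow> 'a \<Rightarrow> 'a \<times> 'a" where
  "pb S f g = (SOME (p, q). is_pullback S f g p q)"

definition pb1 :: "('o, 'a) cat \<Rightarrow> 'a \<Rightarrow> 'a \<Rightarrow> 'a" where
  "pb1 S f g = fst (pb S f g)"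

definition pb2 :: "('o, 'a) cat \<Rightarrow> 'a \<Rightarrow> 'a \<Rightarrow> 'a" where
  "pb2 S f g = snd (pb S f g)"

definition pbobj :: "('o, 'a) cat \<Rightarrow> 'a \<Rightarrow> 'a \<Rightarrow> 'o" where
  "pbobj S f g = Dom S (pb1 S f g)"

definition pbpair :: "('o, 'a) cat \<Rightarrow> 'a \<Rightarrow> 'a \<Rightarrow> 'a \<Rightarrow> 'a \<Rightarrow> 'a" where
  "pbpair S f g = pairing S (pb1 S f g) (pb2 S f g)"


section \<open>Internal categories and internal diagrams\<close>

record ('o, 'a) icat =
  C0 :: 'o
  C1 :: 'o
  d0 :: 'a
  d1 :: 'a
  idn :: 'a     \<comment> \<open>the identities \<open>y : C0 \<rightarrow> C1\<close>\<close>
  tensor :: 'a  \<comment> \<open>the composition, in diagrammatic order\<close>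

text \<open>In both associativity laws below, the triple pullback is formed as
  \<open>(X \<times>\<^bsub>C0\<^esub> C1) \<times>\<^bsub>C0\<^esub> C1\<close>, with projections \<open>p\<close> to \<open>X \<times>\<^bsub>C0\<^esub> C1\<close> and \<open>q\<close> to \<open>C1\<close>, where \<open>X = C1\<close>
  in the case of an internal category. Then \<open>m \<times> 1 = \<langle>m p, q\<rangle>\<close> and
  \<open>1 \<times> \<otimes> = \<langle>\<pi>\<^sub>1 p, \<otimes>\<langle>\<pi>\<^sub>2 p, q\<rangle>\<rangle>\<close>.\<close>

locale internal_category =
  fixes S :: "('o, 'a) cat" (structure) and C :: "('o, 'a) icat"
  assumes C0_obj: "C0 C \<in> Obj S" and C1_obj: "C1 C \<in> Obj S"
    and d0_hom: "d0 C \<in> hom S (C1 C) (C0 C)"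
    and d1_hom: "d1 C \<in> hom S (C1 C) (C0 C)"
    and idn_hom: "idn C \<in> hom S (C0 C) (C1 C)"
    and tensor_hom: "tensor C \<in> hom S (pbobj S (d1 C) (d0 C)) (C1 C)"
    and d0_idn: "d0 C \<cdot> idn C = Id S (C0 C)"
    and d1_idn: "d1 C \<cdot> idn C = Id S (C0 C)"
    and d0_tensor: "d0 C \<cdot> tensor C = d0 C \<cdot> pb1 S (d1 C) (d0 C)"
    and d1_tensor: "d1 C \<cdot> tensor C = d1 C \<cdot> pb2 S (d1 C) (d0 C)"
    and tensor_unit_left:
      "tensor C \<cdot> pbpair S (d1 C) (d0 C) (idn C \<cdot> d0 C) (Id S (C1 C)) = Id S (C1 C)"
    and tensor_unit_right:
      "tensor C \<cdot> pbpair S (d1 C) (d0 C) (Id S (C1 C)) (idn C \<cdot> d1 C) = Id S (C1 C)"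
    and tensor_assoc:
      "let p = pb1 S (d1 C \<cdot> pb2 S (d1 C) (d0 C)) (d0 C);
           q = pb2 S (d1 C \<cdot> pb2 S (d1 C) (d0 C)) (d0 C)
       in tensor C \<cdot> pbpair S (d1 C) (d0 C) (tensor C \<cdot> p) q =
          tensor C \<cdot> pbpair S (d1 C) (d0 C) (pb1 S (d1 C) (d0 C) \<cdot> p)
            (tensor C \<cdot> pbpair S (d1 C) (d0 C) (pb2 S (d1 C) (d0 C) \<cdot> p) q)"

record ('o, 'a) diagram =
  Carr :: 'o
  Str :: 'a  \<comment> \<open>the structure map \<open>\<gamma> : X \<rightarrow> C0\<close>\<close>
  Act :: 'a  \<comment> \<open>the action \<open>m : X \<times>\<^bsub>C0\<^esub> C1 \<rightarrow> X\<close>\<close>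

locale internal_diagram =
  fixes S :: "('o, 'a) cat" (structure) and C :: "('o, 'a) icat" and X :: "('o, 'a) diagram"
  assumes Carr_obj: "Carr X \<in> Obj S"
    and Str_hom: "Str X \<in> hom S (Carr X) (C0 C)"
    and Act_hom: "Act X \<in> hom S (pbobj S (Str X) (d0 C)) (Carr X)"
    and Str_Act: "Str X \<cdot> Act X = d1 C \<cdot> pb2 S (Str X) (d0 C)"
    and Act_assoc:
      "let p = pb1 S (d1 C \<cdot> pb2 S (Str X) (d0 C)) (d0 C);
           q = pb2 S (d1 C \<cdot> pb2 S (Str X) (d0 C)) (d0 C)
       in Act X \<cdot> pbpair S (Str X) (d0 C) (Act X \<cdot> p) q =
          Act X \<cdot> pbpair S (Str X) (d0 C) (pb1 S (Str X) (d0 C) \<cdot> p)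
            (tensor C \<cdot> pbpair S (d1 C) (d0 C) (pb2 S (Str X) (d0 C) \<cdot> p) q)"
    and Act_unit: "Act X \<cdot> pbpair S (Str X) (d0 C) (Id S (Carr X)) (idn C \<cdot> Str X) = Id S (Carr X)"

definition diagram_map ::
    "('o, 'a) cat \<Rightarrow> ('o, 'a) icat \<Rightarrow> ('o, 'a) diagram \<Rightarrow> ('o, 'a) diagram \<Rightarrow> 'a \<Rightarrow> bool" where
  "diagram_map S C X Y h \<longleftrightarrow> h \<in> hom S (Carr X) (Carr Y) \<and> Str Y \<cdot>\<^bsub>S\<^esub> h = Str X \<and>
    h \<cdot>\<^bsub>S\<^esub> Act X = Act Y \<cdot>\<^bsub>S\<^esub>
      pbpair S (Str Y) (d0 C) (h \<cdot>\<^bsub>S\<^esub> pb1 S (Str X) (d0 C)) (pb2 S (Str X) (d0 C))"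

text \<open>The category \<open>[C, S]\<close>. Its arrows carry their source and target, since one and the same arrow
  of \<open>S\<close> can underlie morphisms between different diagrams.\<close>

type_synonym ('o, 'a) diagram_arr = "('o, 'a) diagram \<times> 'a \<times> ('o, 'a) diagram"

definition underlying :: "('o, 'a) diagram_arr \<Rightarrow> 'a" where
  "underlying u = fst (snd u)"

definition diagrams ::
    "('o, 'a) cat \<Rightarrow> ('o, 'a) icat \<Rightarrow> (('o, 'a) diagram, ('o, 'a) diagram_arr) cat" where
  "diagrams S C = \<lparr>
     Obj = {X. internal_diagram S C X},
     Arr = {(X, h, Y) | X h Y. internal_diagram S C X \<and> internal_diagram S C Y \<and> diagram_map S C X Y h},
     Dom = (\<lambda>u. fst u),
     Cod = (\<lambda>u. snd (snd u)),
     Id = (\<lambda>X. (X, Id S (Carr X), X)),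
     Comp = (\<lambda>v u. (fst u, underlying v \<cdot>\<^bsub>S\<^esub> underlying u, snd (snd v)))\<rparr>"


section \<open>Forcing\<close>

text \<open>\<open>f\<^sub>! a = m\<langle>a, f\<rangle>\<close>\<close>

definition push ::
    "('o, 'a) cat \<Rightarrow> ('o, 'a) icat \<Rightarrow> ('o, 'a) diagram \<Rightarrow> 'a \<Rightarrow> 'a \<Rightarrow> 'a" where
  "push S C X f a = Act X \<cdot>\<^bsub>S\<^esub> pbpair S (Str X) (d0 C) a f"

text \<open>\<open>s\<close> is a factorization of the generalized element \<open>a\<close> over \<open>c\<close> through \<open>u\<close>, over \<open>C0\<close>.\<close>

definition factors_through ::
    "('o, 'a) cat \<Rightarrow> ('o, 'a) diagram_arr \<Rightarrow> 'a \<Rightarrow> 'a \<Rightarrow> bool" where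
  "factors_through S u c a \<longleftrightarrow>
    (\<exists>s\<in>hom S (Dom S a) (Carr (fst u)). Str (fst u) \<cdot>\<^bsub>S\<^esub> s = c \<and> underlying u \<cdot>\<^bsub>S\<^esub> s = a)"

text \<open>\<open>c \<tturnstile> \<phi>(a)\<close>, where \<open>u : S\<^sub>\<phi> \<rightarrow> X\<close> is a pullback of \<open>tr\<close> along \<open>\<phi> : X \<rightarrow> \<Omega>\<close> in \<open>[C, S]\<close>. By
  \<open>forces_iff\<close> below it does not matter which one.\<close>

definition forces ::
    "('o, 'a) cat \<Rightarrow> ('o, 'a) icat \<Rightarrow> ('o, 'a) diagram_arr \<Rightarrow> ('o, 'a) diagram_arr \<Rightarrow>
      'a \<Rightarrow> 'a \<Rightarrow> bool" where
  "forces S C tr \<phi> c a \<longleftrightarrow> a \<in> hom S (Dom S c) (Carr (fst \<phi>)) \<and> c \<in> hom S (Dom S c) (C0 C) \<and>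
    Str (fst \<phi>) \<cdot>\<^bsub>S\<^esub> a = c \<and>
    (\<exists>u t. is_pullback (diagrams S C) \<phi> tr u t \<and> factors_through S u c a)"

lemma diagrams_homD:
  assumes "u \<in> hom (diagrams S C) X Y"
  shows "u = (X, underlying u, Y)" "internal_diagram S C X" "internal_diagram S C Y"
    "diagram_map S C X Y (underlying u)"
  using assms by (auto simp: hom_def diagrams_def underlying_def)

lemma underlying_Comp: "underlying (v \<cdot>\<^bsub>diagrams S C\<^esub> u) = underlying v \<cdot>\<^bsub>S\<^esub> underlying u"
  by (simp add: diagrams_def underlying_def)

lemma forces_iff:
  assumes S: "category S"
    and \<phi>: "\<phi> \<in> hom (diagrams S C) X \<Omega>"
    and pb: "is_pullback (diagrams S C) \<phi> tr u t"
    and c: "c \<in> hom S Z (C0 C)" and a: "a \<in> hom S Z (Carr X)" and ac: "Str X \<cdot>\<^bsub>S\<^esub> a = c"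
  shows "forces S C tr \<phi> c a \<longleftrightarrow> factors_through S u c a"
proof
  interpret category S by (rule S)
  let ?D = "diagrams S C"
  have Dom_fst [simp]: "Dom ?D v = fst v" for v by (simp add: diagrams_def)
  assume "forces S C tr \<phi> c a"
  then obtain u' t' where pb': "is_pullback ?D \<phi> tr u' t'" and fac: "factors_through S u' c a"
    unfolding forces_def by blast
  from fac obtain s where s: "s \<in> hom S (Dom S a) (Carr (fst u'))"
      "Str (fst u') \<cdot>\<^bsub>S\<^esub> s = c" "underlying u' \<cdot>\<^bsub>S\<^esub> s = a"
    unfolding factors_through_def by blast
  have uu: "u \<in> hom ?D (fst u) (fst \<phi>)" using pb by (simp add: is_pullback_def)
  from pb pb' obtain h where h: "h \<in> hom ?D (fst u') (fst u)" and uh: "u \<cdot>\<^bsub>?D\<^esub> h = u'"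
    by (simp add: is_pullback_def) metis
  let ?h = "underlying h"
  have h1: "?h \<in> hom S (Carr (fst u')) (Carr (fst u))" "Str (fst u) \<cdot>\<^bsub>S\<^esub> ?h = Str (fst u')"
    using diagrams_homD(4)[OF h] by (auto simp: diagram_map_def)
  have u1: "underlying u \<in> hom S (Carr (fst u)) (Carr (fst \<phi>))"
    using diagrams_homD(4)[OF uu] by (auto simp: diagram_map_def)
  have str: "Str (fst u) \<in> hom S (Carr (fst u)) (C0 C)"
    using diagrams_homD(2)[OF uu] by (rule internal_diagram.Str_hom)
  have "underlying u \<cdot>\<^bsub>S\<^esub> (?h \<cdot>\<^bsub>S\<^esub> s) = a"
    using Comp_assoc[OF s(1) h1(1) u1] s(3) underlying_Comp[of S C u h] uh by simp
  moreover have "Str (fst u) \<cdot>\<^bsub>S\<^esub> (?h \<cdot>\<^bsub>S\<^esub> s) = c"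
    using Comp_assoc[OF s(1) h1(1) str] s(2) h1(2) by simp
  ultimately show "factors_through S u c a"
    unfolding factors_through_def using Comp_hom[OF s(1) h1(1)] by blast
next
  assume "factors_through S u c a"
  moreover have "fst \<phi> = X" using diagrams_homD(1)[OF \<phi>] by (metis fst_conv)
  moreover have "Dom S c = Z" using c by (simp add: hom_def)
  ultimately show "forces S C tr \<phi> c a" unfolding forces_def using pb c a ac by blast
qed

end

theory Submission
  imports Defs
begin

text \<open>
  The truth of \<open>\<phi>(a)\<close> persists along \<open>f\<close> because the subobject \<open>u : S\<^sub>\<phi> \<rightarrow> X\<close> is taken in the category
  of diagrams: \<open>S\<^sub>\<phi>\<close> has an action of its own and \<open>u\<close> commutes with the actions. If \<open>a = u s\<close>, then
  the generalized element \<open>s\<close> of \<open>S\<^sub>\<phi>\<close> can itself be pushed along \<open>f\<close>, and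
  \<open>u (f\<^sub>! s) = f\<^sub>! (u s) = f\<^sub>! a\<close>, so \<open>f\<^sub>! s\<close> is a factorization of \<open>f\<^sub>! a\<close>. It lies over \<open>d\<close> because
  the action carries elements over the domain of \<open>f\<close> to elements over its codomain
  (\<open>push_over_codomain\<close>). The heart of the matter is thus \<open>diagram_map_push\<close>, the naturality of
  pushing along \<open>f\<close>; it is the equivariance square of a diagram map, read at the generalized
  element \<open>\<langle>s, f\<rangle>\<close> of the pullback on which the action is defined.
\<close>

context topos
begin

lemma is_pullback_pb:
  assumes "f \<in> hom S A D" "g \<in> hom S B D"
  shows "is_pullback S f g (pb1 S f g) (pb2 S f g)"
proof -
  have "\<exists>x. case x of (p, q) \<Rightarrow> is_pullback S f g p q"
    using has_pullbacks[OF assms] by auto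
  then have "case pb S f g of (p, q) \<Rightarrow> is_pullback S f g p q"
    unfolding pb_def by (rule someI_ex)
  then show ?thesis by (simp add: pb1_def pb2_def split_beta)
qed

lemma pb_proj_hom:
  assumes "f \<in> hom S A D" "g \<in> hom S B D"
  shows "pb1 S f g \<in> hom S (pbobj S f g) A" "pb2 S f g \<in> hom S (pbobj S f g) B"
    and "f \<cdot> pb1 S f g = g \<cdot> pb2 S f g"
  using is_pullback_pb[OF assms] assms by (auto simp: is_pullback_def pbobj_def hom_def)

lemma pb_universal:
  assumes "f \<in> hom S A D" "g \<in> hom S B D"
    and "a \<in> hom S Z A" "b \<in> hom S Z B" "f \<cdot> a = g \<cdot> b"
  shows "\<exists>!h. h \<in> hom S Z (pbobj S f g) \<and> pb1 S f g \<cdot> h = a \<and> pb2 S f g \<cdot> h = b"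
proof -
  have "Dom S f = A" "Dom S g = B" using assms(1,2) by (auto simp: hom_def)
  then show ?thesis
    using is_pullback_pb[OF assms(1,2)] assms(3-5) unfolding is_pullback_def pbobj_def by blast
qed

lemma pbpair:
  assumes "f \<in> hom S A D" "g \<in> hom S B D"
    and "a \<in> hom S Z A" "b \<in> hom S Z B" "f \<cdot> a = g \<cdot> b"
  shows pbpair_hom: "pbpair S f g a b \<in> hom S Z (pbobj S f g)"
    and pb1_pbpair: "pb1 S f g \<cdot> pbpair S f g a b = a"
    and pb2_pbpair: "pb2 S f g \<cdot> pbpair S f g a b = b"
proof -
  have "Dom S a = Z" using assms(3) by (simp add: hom_def)
  then show "pbpair S f g a b \<in> hom S Z (pbobj S f g)"
    "pb1 S f g \<cdot> pbpair S f g a b = a" "pb2 S f g \<cdot> pbpair S f g a b = b"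
    using theI'[OF pb_universal[OF assms]] by (simp_all add: pbpair_def pairing_def pbobj_def)
qed

lemma pbpair_eqI:
  assumes "f \<in> hom S A D" "g \<in> hom S B D"
    and "a \<in> hom S Z A" "b \<in> hom S Z B" "f \<cdot> a = g \<cdot> b"
    and "h \<in> hom S Z (pbobj S f g)" "pb1 S f g \<cdot> h = a" "pb2 S f g \<cdot> h = b"
  shows "h = pbpair S f g a b"
  using pb_universal[OF assms(1-5)] pbpair[OF assms(1-5)] assms(6-8) by blast

lemma pbpair_Comp:
  assumes f: "f \<in> hom S A D" and g: "g \<in> hom S B D"
    and a: "a \<in> hom S Z A" and b: "b \<in> hom S Z B" and ab: "f \<cdot> a = g \<cdot> b"
    and h: "h \<in> hom S W Z"
  shows "pbpair S f g a b \<cdot> h = pbpair S f g (a \<cdot> h) (b \<cdot> h)"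
proof (rule pbpair_eqI[OF f g])
  note P = pbpair[OF f g a b ab] and p = pb_proj_hom[OF f g]
  show "a \<cdot> h \<in> hom S W A" "b \<cdot> h \<in> hom S W B" using Comp_hom h a b by blast+
  show "f \<cdot> (a \<cdot> h) = g \<cdot> (b \<cdot> h)"
    using Comp_assoc[OF h a f] Comp_assoc[OF h b g] ab by simp
  show "pbpair S f g a b \<cdot> h \<in> hom S W (pbobj S f g)" by (rule Comp_hom[OF h P(1)])
  show "pb1 S f g \<cdot> (pbpair S f g a b \<cdot> h) = a \<cdot> h" using Comp_assoc[OF h P(1) p(1)] P(2) by simp
  show "pb2 S f g \<cdot> (pbpair S f g a b \<cdot> h) = b \<cdot> h" using Comp_assoc[OF h P(1) p(2)] P(3) by simp
qed

lemma push_hom: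
  assumes C: "internal_category S C" and X: "internal_diagram S C X"
    and a: "a \<in> hom S Z (Carr X)" and f: "f \<in> hom S Z (C1 C)" and af: "Str X \<cdot> a = d0 C \<cdot> f"
  shows "push S C X f a \<in> hom S Z (Carr X)"
  unfolding push_def
  by (rule Comp_hom[OF pbpair_hom[OF internal_diagram.Str_hom[OF X] internal_category.d0_hom[OF C] a f af]
        internal_diagram.Act_hom[OF X]])

lemma push_over_codomain:
  assumes C: "internal_category S C" and X: "internal_diagram S C X"
    and a: "a \<in> hom S Z (Carr X)" and f: "f \<in> hom S Z (C1 C)" and af: "Str X \<cdot> a = d0 C \<cdot> f"
  shows "Str X \<cdot> push S C X f a = d1 C \<cdot> f"
proof -
  note str = internal_diagram.Str_hom[OF X] and act = internal_diagram.Act_hom[OF X]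
    and d0 = internal_category.d0_hom[OF C] and d1 = internal_category.d1_hom[OF C]
  note P = pbpair[OF str d0 a f af]
  have "Str X \<cdot> push S C X f a = (Str X \<cdot> Act X) \<cdot> pbpair S (Str X) (d0 C) a f"
    unfolding push_def by (rule Comp_assoc[OF P(1) act str])
  also have "\<dots> = (d1 C \<cdot> pb2 S (Str X) (d0 C)) \<cdot> pbpair S (Str X) (d0 C) a f"
    by (simp add: internal_diagram.Str_Act[OF X])
  also have "\<dots> = d1 C \<cdot> f"
    using Comp_assoc[OF P(1) pb_proj_hom(2)[OF str d0] d1] P(3) by simp
  finally show ?thesis .
qed

text \<open>
  Equivariance of \<open>h\<close> says \<open>h m = m (h \<times> 1)\<close>. Precomposing with \<open>\<langle>a, f\<rangle>\<close> turns the left side into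
  \<open>h (f\<^sub>! a)\<close> and, as \<open>(h \<times> 1) \<langle>a, f\<rangle> = \<langle>h a, f\<rangle>\<close>, the right side into \<open>f\<^sub>! (h a)\<close>.
\<close>

lemma diagram_map_push:
  assumes C: "internal_category S C" and X: "internal_diagram S C X" and Y: "internal_diagram S C Y"
    and h: "diagram_map S C X Y h"
    and a: "a \<in> hom S Z (Carr X)" and f: "f \<in> hom S Z (C1 C)" and af: "Str X \<cdot> a = d0 C \<cdot> f"
  shows "h \<cdot> push S C X f a = push S C Y f (h \<cdot> a)"
proof -
  note d0 = internal_category.d0_hom[OF C]
  note strX = internal_diagram.Str_hom[OF X] and strY = internal_diagram.Str_hom[OF Y]
  note actX = internal_diagram.Act_hom[OF X] and actY = internal_diagram.Act_hom[OF Y]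
  let ?p = "pb1 S (Str X) (d0 C)" and ?q = "pb2 S (Str X) (d0 C)"
  let ?af = "pbpair S (Str X) (d0 C) a f"
  let ?h1 = "pbpair S (Str Y) (d0 C) (h \<cdot> ?p) ?q"
  note p = pb_proj_hom[OF strX d0] and P = pbpair[OF strX d0 a f af]
  have hh: "h \<in> hom S (Carr X) (Carr Y)" and strh: "Str Y \<cdot> h = Str X"
    and equi: "h \<cdot> Act X = Act Y \<cdot> ?h1"
    using h by (simp_all add: diagram_map_def)
  have hp: "h \<cdot> ?p \<in> hom S (pbobj S (Str X) (d0 C)) (Carr Y)" by (rule Comp_hom[OF p(1) hh])
  have over: "Str Y \<cdot> (h \<cdot> ?p) = d0 C \<cdot> ?q"
    using Comp_assoc[OF p(1) hh strY] strh p(3) by simp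
  have "h \<cdot> push S C X f a = (h \<cdot> Act X) \<cdot> ?af"
    unfolding push_def by (rule Comp_assoc[OF P(1) actX hh])
  also have "\<dots> = Act Y \<cdot> (?h1 \<cdot> ?af)"
    using Comp_assoc[OF P(1) pbpair_hom[OF strY d0 hp p(2) over] actY] equi by simp
  also have "?h1 \<cdot> ?af = pbpair S (Str Y) (d0 C) (h \<cdot> a) f"
    using pbpair_Comp[OF strY d0 hp p(2) over P(1)] Comp_assoc[OF P(1) p(1) hh] P(2,3) by simp
  finally show ?thesis by (simp add: push_def)
qed

lemma factors_through_push:
  assumes C: "internal_category S C" and u: "u \<in> hom (diagrams S C) Y X"
    and f: "f \<in> hom S Z (C1 C)" and a: "a \<in> hom S Z (Carr X)" and af: "Str X \<cdot> a = d0 C \<cdot> f"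
    and fac: "factors_through S u (d0 C \<cdot> f) a"
  shows "factors_through S u (d1 C \<cdot> f) (push S C X f a)"
proof -
  note Y = diagrams_homD(2)[OF u] and X = diagrams_homD(3)[OF u] and um = diagrams_homD(4)[OF u]
  have [simp]: "fst u = Y" using diagrams_homD(1)[OF u] by (metis fst_conv)
  have "Dom S a = Z" using a by (simp add: hom_def)
  then obtain s where s: "s \<in> hom S Z (Carr Y)" "Str Y \<cdot> s = d0 C \<cdot> f" "underlying u \<cdot> s = a"
    using fac unfolding factors_through_def by auto
  have "underlying u \<cdot> push S C Y f s = push S C X f a"
    using diagram_map_push[OF C Y X um s(1) f s(2)] s(3) by simp
  moreover have "Dom S (push S C X f a) = Z"
    using push_hom[OF C X a f af] by (simp add: hom_def)
  ultimately show ?thesis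
    unfolding factors_through_def
    using push_hom[OF C Y s(1) f s(2)] push_over_codomain[OF C Y s(1) f s(2)] by auto
qed

end

theorem lemma7p6:
  fixes S :: "('o, 'a) cat" and C :: "('o, 'a) icat"
    and X \<Omega> :: "('o, 'a) diagram" and tr \<phi> :: "('o, 'a) diagram_arr"
    and Z :: 'o and c d a f :: 'a
  assumes "topos S"
    and "internal_category S C"
    and "is_subobject_classifier (diagrams S C) \<Omega> tr"
    and "\<phi> \<in> hom (diagrams S C) X \<Omega>"
    and "c \<in> hom S Z (C0 C)"
    and "a \<in> hom S Z (Carr X)"
    and "Str X \<cdot>\<^bsub>S\<^esub> a = c"
    and "forces S C tr \<phi> c a"
    and "f \<in> hom S Z (C1 C)"
    and "d0 C \<cdot>\<^bsub>S\<^esub> f = c"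
    and "d1 C \<cdot>\<^bsub>S\<^esub> f = d"
  shows "forces S C tr \<phi> d (push S C X f a)"
proof -
  interpret topos S by (rule assms(1))
  note C = assms(2) and \<phi> = assms(4) and a = assms(6) and f = assms(9)
  have X: "internal_diagram S C X" by (rule diagrams_homD(2)[OF \<phi>])
  have fst_\<phi>: "fst \<phi> = X" using diagrams_homD(1)[OF \<phi>] by (metis fst_conv)
  obtain u t where pb: "is_pullback (diagrams S C) \<phi> tr u t" and fac: "factors_through S u c a"
    using assms(8) unfolding forces_def by blast
  have "Dom (diagrams S C) v = fst v" for v by (simp add: diagrams_def)
  then have u: "u \<in> hom (diagrams S C) (fst u) X"
    using pb fst_\<phi> by (simp add: is_pullback_def)
  have af: "Str X \<cdot>\<^bsub>S\<^esub> a = d0 C \<cdot>\<^bsub>S\<^esub> f" using assms(7,10) by simp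
  have d: "d \<in> hom S Z (C0 C)"
    using Comp_hom[OF f internal_category.d1_hom[OF C]] assms(11) by simp
  have over_d: "Str X \<cdot>\<^bsub>S\<^esub> push S C X f a = d"
    using push_over_codomain[OF C X a f af] assms(11) by simp
  have "factors_through S u d (push S C X f a)"
    using factors_through_push[OF C u f a af] fac assms(10,11) by simp
  then show ?thesis
    using forces_iff[OF category_axioms \<phi> pb d push_hom[OF C X a f af] over_d] by blast
qed

end
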